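(* Run the W-TQA procedure described in the context with step size $\gamma>0$. Assume that target feedback is missing completely at random in the following sense: there exists $\pi\in(0,1]$ such that \[ \mathbb P(R_t=1\mid\mathcal H_t)=\pi\quad\text{a.s. for all }t\ge1,\qquad\text{where }\mathcal H_t:=\mathcal F_t\vee\sigma(Y_{N+1,t}). \] Then, for every $T\ge1$, \[ \left|\frac1T\sum_{t=1}^T\mathbb P\!\left(Y_{N+1,t}\notin C_t(X_{N+1,t})\right)-\alpha\right|\le\frac{\max\{\alpha,1-\alpha\}+\gamma}{\pi T\gamma}. \] In particular, $\lim_{T\to\infty}\frac1T\sum_{t=1}^T\mathbb P\!\left(Y_{N+1,t}\notin C_t(X_{N+1,t})\right)=\alpha$.
   Context: All random quantities live on a common probability space $(\Omega,\mathcal A,\mathbb P)$. Panel stream. Fix integers $N\ge1$, $d\ge1$. For units $i=1,\dots,N+1$ and rounds $t=1,2,\dots$ there are random pairs $(X_{i,t},Y_{i,t})\in\mathbb R^d\times\mathbb R$; units $1,\dots,N$ are calibration units and unit $N+1$ is the target. No exchangeability is assumed. $R_t\in\{0,1\}$ indicates whether $Y_{N+1,t}$ is revealed (after prediction); by convention $R_0=0$ and $Y_{N+1,0}=0$. The batch observed at round $t$ is $\mathcal O_t=(X_{1,t},Y_{1,t},\dots,X_{N,t},Y_{N,t},X_{N+1,t},R_{t-1},R_{t-1}Y_{N+1,t-1})$, and $\mathcal F_t=\sigma(\mathcal O_1,\dots,\mathcal O_t)$, with $\mathcal F_0$ trivial. Score. $\hat s:\mathbb R^d\times\mathbb R\to\mathbb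 R$ is a fixed (nonrandom) measurable function, and $\hat s_{i,t}:=\hat s(X_{i,t},Y_{i,t})$. W-TQA procedure, with parameters $\alpha\in[0,1]$, bandwidth $h>0$, stepsize $\gamma>0$. Initialize $\alpha_0=\alpha$, $\widehat\mu_{k,0}=0$, and $w^{(1)}_{N+1,k}=1/(N+1)$ for $k=1,\dots,N+1$. At each round $t=1,2,\dots$: (1) If $R_{t-1}=1$, set $\alpha_t=\alpha_{t-1}+\gamma(\alpha-\ell_{t-1})$, where $\ell_{t-1}=\mathbf 1\{Y_{N+1,t-1}\notin C_{t-1}(X_{N+1,t-1})\}$; otherwise set $\alpha_t=\alpha_{t-1}$. (2) Let $\widetilde s_t=(\hat s_{1,t},\dots,\hat s_{N,t},+\infty)$ and $\hat q_t=\inf\{q\in[-\infty,+\infty]:\sum_{k=1}^{N+1}w^{(t)}_{N+1,k}\mathbf 1\{(\widetilde s_t)_k\le q\}\ge 1-\alpha_t\}$, with $\inf\emptyset=+\infty$. The prediction set is $C_t(X_{N+1,t})=\{y\in\mathbb R:\hat s(X_{N+1,t},y)\le\hat q_t\}$ (so $\alpha_t>1$ gives the empty set, $\alpha_t<0$ gives $\mathbb R$). (3) Set $\widehat\mu_{k,t}=\frac1t\sum_{s=1}^tX_{k,s}$ for $k\le N+1$, $a_{k,t}=\exp\{-\|\widehat\mu_{k,t}-\widehat\mu_{N+1,t}\|_2^2/(2h^2)\}$ for $k\le N$, $a_{N+1,t}=1$, and $w^{(t+1)}_{N+1,k}=a_{k,t}/\sum_{j=1}^{N+1}a_{j,t}$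 for $k\le N+1$. *)

theory Defs
  imports "HOL-Probability.Probability"
begin

text \<open>
  The procedure is defined pathwise: \<open>x k t\<close>, \<open>y k t\<close> and \<open>r t\<close> are realized values of
  the covariate and response of unit \<open>k\<close> at round \<open>t\<close> and of the feedback indicator at
  round \<open>t\<close>. Units are numbered \<open>1, \<dots>, N + 1\<close>, with \<open>N + 1\<close> the target.
\<close>

text \<open>For \<open>t = 0\<close> the sum is empty, so the value is \<open>0\<close>, the required initialization.\<close>

definition feature_mean :: "(nat \<Rightarrow> nat \<Rightarrow> real ^ 'd) \<Rightarrow> nat \<Rightarrow> nat \<Rightarrow> real ^ 'd" where
  "feature_mean x k t = (1 / real t) *\<^sub>R (\<Sum>s = 1..t. x k s)"

definition affinity ::
  "nat \<Rightarrow> real \<Rightarrow> (nat \<Rightarrow> nat \<Rightarrow> real ^ 'd) \<Rightarrow> nat \<Rightarrow> nat \<Rightarrow> real" where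
  "affinity N h x k t =
     (if k = N + 1 then 1
      else exp (- ((norm (feature_mean x k t - feature_mean x (N + 1) t))\<^sup>2 / (2 * h\<^sup>2))))"

text \<open>\<open>weight N h x t k\<close> is the weight of unit \<open>k\<close> used at round \<open>t\<close>, which is computed
  from the covariates up to round \<open>t - 1\<close>; only rounds \<open>t \<ge> 1\<close> matter.\<close>

definition weight ::
  "nat \<Rightarrow> real \<Rightarrow> (nat \<Rightarrow> nat \<Rightarrow> real ^ 'd) \<Rightarrow> nat \<Rightarrow> nat \<Rightarrow> real" where
  "weight N h x t k =
     (if t \<le> 1 then 1 / real (N + 1)
      else affinity N h x k (t - 1) / (\<Sum>j = 1..N + 1. affinity N h x j (t - 1)))"

definition padded_score ::
  "nat \<Rightarrow> ((real ^ 'd) \<times> real \<Rightarrow> real) \<Rightarrow> (nat \<Rightarrow> nat \<Rightarrow> real ^ 'd) \<Rightarrow> (nat \<Rightarrow> nat \<Rightarrow> real)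
    \<Rightarrow> nat \<Rightarrow> nat \<Rightarrow> ereal" where
  "padded_score N s x y t k = (if k = N + 1 then \<infinity> else ereal (s (x k t, y k t)))"

text \<open>The argument \<open>a\<close> is the current level \<open>\<alpha>\<^sub>t\<close>. In \<^typ>\<open>ereal\<close>, the infimum of the empty
  set is \<open>\<infinity>\<close>.\<close>

definition threshold ::
  "nat \<Rightarrow> ((real ^ 'd) \<times> real \<Rightarrow> real) \<Rightarrow> real \<Rightarrow> (nat \<Rightarrow> nat \<Rightarrow> real ^ 'd)
    \<Rightarrow> (nat \<Rightarrow> nat \<Rightarrow> real) \<Rightarrow> real \<Rightarrow> nat \<Rightarrow> ereal" where
  "threshold N s h x y a t =
     Inf {q :: ereal.
       (\<Sum>k = 1..N + 1. weight N h x t k * of_bool (padded_score N s x y t k \<le> q)) \<ge> 1 - a}"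

definition set_at_level ::
  "nat \<Rightarrow> ((real ^ 'd) \<times> real \<Rightarrow> real) \<Rightarrow> real \<Rightarrow> (nat \<Rightarrow> nat \<Rightarrow> real ^ 'd)
    \<Rightarrow> (nat \<Rightarrow> nat \<Rightarrow> real) \<Rightarrow> real \<Rightarrow> nat \<Rightarrow> real ^ 'd \<Rightarrow> real set" where
  "set_at_level N s h x y a t v = {z. ereal (s (v, z)) \<le> threshold N s h x y a t}"

text \<open>At the step from round \<open>0\<close> to round \<open>1\<close> no update takes place, because \<open>r 0 = 0\<close>.\<close>

primrec wtqa_level ::
  "nat \<Rightarrow> ((real ^ 'd) \<times> real \<Rightarrow> real) \<Rightarrow> real \<Rightarrow> real \<Rightarrow> real \<Rightarrow> (nat \<Rightarrow> nat \<Rightarrow> real ^ 'd)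
    \<Rightarrow> (nat \<Rightarrow> nat \<Rightarrow> real) \<Rightarrow> (nat \<Rightarrow> real) \<Rightarrow> nat \<Rightarrow> real" where
  "wtqa_level N s \<alpha> h \<gamma> x y r 0 = \<alpha>"
| "wtqa_level N s \<alpha> h \<gamma> x y r (Suc t) =
     (if r t = 1
      then wtqa_level N s \<alpha> h \<gamma> x y r t
             + \<gamma> * (\<alpha> - of_bool (y (N + 1) t
                   \<notin> set_at_level N s h x y (wtqa_level N s \<alpha> h \<gamma> x y r t) t (x (N + 1) t)))
      else wtqa_level N s \<alpha> h \<gamma> x y r t)"

definition wtqa_set ::
  "nat \<Rightarrow> ((real ^ 'd) \<times> real \<Rightarrow> real) \<Rightarrow> real \<Rightarrow> real \<Rightarrow> real \<Rightarrow> (nat \<Rightarrow> nat \<Rightarrow> real ^ 'd)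
    \<Rightarrow> (nat \<Rightarrow> nat \<Rightarrow> real) \<Rightarrow> (nat \<Rightarrow> real) \<Rightarrow> nat \<Rightarrow> real ^ 'd \<Rightarrow> real set" where
  "wtqa_set N s \<alpha> h \<gamma> x y r t v =
     set_at_level N s h x y (wtqa_level N s \<alpha> h \<gamma> x y r t) t v"

text \<open>The batch observed at round \<open>t\<close>: calibration pairs, target covariate, and the delayed
  feedback \<open>(R\<^bsub>t-1\<^esub>, R\<^bsub>t-1\<^esub> Y\<^bsub>N+1,t-1\<^esub>)\<close>.\<close>

definition batch ::
  "nat \<Rightarrow> (nat \<Rightarrow> nat \<Rightarrow> 'w \<Rightarrow> real ^ 'd) \<Rightarrow> (nat \<Rightarrow> nat \<Rightarrow> 'w \<Rightarrow> real) \<Rightarrow> (nat \<Rightarrow> 'w \<Rightarrow> real)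
    \<Rightarrow> nat \<Rightarrow> 'w \<Rightarrow> (nat \<Rightarrow> (real ^ 'd) \<times> real) \<times> (real ^ 'd) \<times> real \<times> real" where
  "batch N X Y R t \<omega> =
     (\<lambda>i\<in>{1..N}. (X i t \<omega>, Y i t \<omega>), X (N + 1) t \<omega>,
      R (t - 1) \<omega>, R (t - 1) \<omega> * Y (N + 1) (t - 1) \<omega>)"

definition batch_space ::
  "nat \<Rightarrow> ((nat \<Rightarrow> (real ^ 'd) \<times> real) \<times> (real ^ 'd) \<times> real \<times> real) measure" where
  "batch_space N = (\<Pi>\<^sub>M i\<in>{1..N}. borel) \<Otimes>\<^sub>M borel \<Otimes>\<^sub>M borel \<Otimes>\<^sub>M borel"

text \<open>Sub-\<open>\<sigma>\<close>-algebras of \<open>M\<close> are represented by measure spaces over the same carrier, as in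
  \<^const>\<open>real_cond_exp\<close>; only their measurable sets are relevant. For \<open>t = 0\<close> there are no
  generators, so \<open>obs_algebra\<close> is the trivial \<open>\<sigma>\<close>-algebra.\<close>

definition obs_algebra ::
  "'w measure \<Rightarrow> nat \<Rightarrow> (nat \<Rightarrow> nat \<Rightarrow> 'w \<Rightarrow> real ^ 'd) \<Rightarrow> (nat \<Rightarrow> nat \<Rightarrow> 'w \<Rightarrow> real)
    \<Rightarrow> (nat \<Rightarrow> 'w \<Rightarrow> real) \<Rightarrow> nat \<Rightarrow> 'w measure" where
  "obs_algebra M N X Y R t =
     sigma (space M)
       (\<Union>u\<in>{1..t}. sets (vimage_algebra (space M) (batch N X Y R u) (batch_space N)))"

definition outcome_algebra ::
  "'w measure \<Rightarrow> nat \<Rightarrow> (nat \<Rightarrow> nat \<Rightarrow> 'w \<Rightarrow> real ^ 'd) \<Rightarrow> (nat \<Rightarrow> nat \<Rightarrow> 'w \<Rightarrow> real)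
    \<Rightarrow> (nat \<Rightarrow> 'w \<Rightarrow> real) \<Rightarrow> nat \<Rightarrow> 'w measure" where
  "outcome_algebra M N X Y R t =
     sigma (space M)
       (sets (obs_algebra M N X Y R t) \<union> sets (vimage_algebra (space M) (Y (N + 1) t) borel))"

definition miscoverage_prob ::
  "'w measure \<Rightarrow> nat \<Rightarrow> ((real ^ 'd) \<times> real \<Rightarrow> real) \<Rightarrow> real \<Rightarrow> real \<Rightarrow> real
    \<Rightarrow> (nat \<Rightarrow> nat \<Rightarrow> 'w \<Rightarrow> real ^ 'd) \<Rightarrow> (nat \<Rightarrow> nat \<Rightarrow> 'w \<Rightarrow> real) \<Rightarrow> (nat \<Rightarrow> 'w \<Rightarrow> real)
    \<Rightarrow> nat \<Rightarrow> real" where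
  "miscoverage_prob M N s \<alpha> h \<gamma> X Y R t =
     measure M {\<omega> \<in> space M. Y (N + 1) t \<omega>
       \<notin> wtqa_set N s \<alpha> h \<gamma> (\<lambda>k u. X k u \<omega>) (\<lambda>k u. Y k u \<omega>) (\<lambda>u. R u \<omega>) t (X (N + 1) t \<omega>)}"

end

theory Submission
  imports Defs
begin

text \<open>
  The level stays in \<open>[-\<gamma>(1 - \<alpha>), 1 + \<gamma>\<alpha>]\<close>: a negative level forces
  coverage and a level above \<open>1\<close> forces miscoverage, so the drift always points back.
  Telescoping the update therefore bounds \<open>\<gamma> \<Sum> R\<^sub>t (\<alpha> - \<ell>\<^sub>t)\<close> pathwise by
  \<open>max \<alpha> (1 - \<alpha>) + \<gamma>\<close>. The loss \<open>\<ell>\<^sub>t\<close> is measurable with respect to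
  the algebra on which \<open>R\<^sub>t\<close> is conditioned, so taking expectations replaces
  \<open>R\<^sub>t\<close> by its conditional probability.
\<close>

section \<open>Weights and confinement of the level\<close>

lemma affinity_pos: "affinity N h x k t > 0"
  by (simp add: affinity_def)

lemma sum_affinity_pos: "(\<Sum>j = 1..N + 1. affinity N h x j t) > 0"
  by (rule sum_pos) (auto simp: affinity_pos)

lemma weight_nonneg: "weight N h x t k \<ge> 0"
  using affinity_pos[of N h x k "t - 1"] sum_affinity_pos[where N=N and h=h and x=x and t="t - 1"]
  by (auto simp: weight_def less_imp_le)

lemma sum_weight: "(\<Sum>k = 1..N + 1. weight N h x t k) = 1"
proof (cases "t \<le> 1")
  case True
  then show ?thesis by (simp add: weight_def del: sum.cl_ivl_Suc)
next
  case False
  then show ?thesis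
    using sum_affinity_pos[where N=N and h=h and x=x and t="t - 1"]
    by (simp add: weight_def sum_divide_distrib[symmetric] del: sum.cl_ivl_Suc)
qed

text \<open>The weights sum to 1, so no threshold can collect the mass \<open>1 - a > 1\<close>. The
  infimum is then over the empty set, hence infinite, and every real score lies below it.\<close>

lemma set_at_level_neg:
  assumes "a < 0"
  shows "set_at_level N s h x y a t v = UNIV"
proof -
  have le: "(\<Sum>k = 1..N + 1. weight N h x t k * of_bool (padded_score N s x y t k \<le> q)) \<le> 1" for q
    unfolding sum_weight[of N h x t, symmetric]
    by (rule sum_mono) (auto simp: weight_nonneg)
  have "\<not> (\<Sum>k = 1..N + 1. weight N h x t k * of_bool (padded_score N s x y t k \<le> q)) \<ge> 1 - a" for q
    using le[of q] assms by linarith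
  then have "threshold N s h x y a t = \<infinity>"
    unfolding threshold_def by (simp add: top_ereal_def del: sum.cl_ivl_Suc)
  then show ?thesis by (simp add: set_at_level_def)
qed

text \<open>The demanded mass \<open>1 - a\<close> is negative, so every extended real qualifies,
  including minus infinity. The infimum is minus infinity, which no real score can meet.\<close>

lemma set_at_level_gt_1:
  assumes "a > 1"
  shows "set_at_level N s h x y a t v = {}"
proof -
  have ge: "(\<Sum>k = 1..N + 1. weight N h x t k * of_bool (padded_score N s x y t k \<le> q)) \<ge> 0" for q
    by (rule sum_nonneg) (auto simp: weight_nonneg)
  have "(\<Sum>k = 1..N + 1. weight N h x t k * of_bool (padded_score N s x y t k \<le> q)) \<ge> 1 - a" for q
    using ge[of q] assms by linarith
  then have "threshold N s h x y a t = -\<infinity>"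
    unfolding threshold_def by (simp add: bot_ereal_def del: sum.cl_ivl_Suc)
  then show ?thesis by (simp add: set_at_level_def)
qed

text \<open>The interval is \<open>[0, 1]\<close> enlarged by the largest single step in each
  direction: a miss lowers the level by \<open>\<gamma> * (1 - \<alpha>)\<close>, a covered round
  raises it by \<open>\<gamma> * \<alpha>\<close>. Each boundary can therefore be overshot by at
  most one step.\<close>

lemma wtqa_level_bounds:
  assumes "0 \<le> \<alpha>" "\<alpha> \<le> 1" "\<gamma> > 0"
  shows "wtqa_level N s \<alpha> h \<gamma> x y r t \<in> {- (\<gamma> * (1 - \<alpha>))..1 + \<gamma> * \<alpha>}"
proof (induction t)
  case 0
  have "0 \<le> \<gamma> * (1 - \<alpha>)" "0 \<le> \<gamma> * \<alpha>" using assms by simp_all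
  then show ?case using assms by (simp only: wtqa_level.simps atLeastAtMost_iff) linarith
next
  case (Suc t)
  define a where "a = wtqa_level N s \<alpha> h \<gamma> x y r t"
  have nn: "0 \<le> \<gamma> * (1 - \<alpha>)" "0 \<le> \<gamma> * \<alpha>" using assms by simp_all
  let ?miss = "y (N + 1) t \<notin> set_at_level N s h x y a t (x (N + 1) t)"
  have step: "wtqa_level N s \<alpha> h \<gamma> x y r (Suc t) =
    (if r t = 1 then if ?miss then a - \<gamma> * (1 - \<alpha>) else a + \<gamma> * \<alpha> else a)"
    by (simp add: a_def algebra_simps)
  \<comment> \<open>Contrapositives of the two degenerate cases: a decrease can only start from a
    level at least 0, an increase only from a level at most 1.\<close>
  have "\<not> ?miss \<or> a \<ge> 0" "?miss \<or> a \<le> 1"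
    by (cases "a < 0"; cases "a > 1"; simp add: set_at_level_neg set_at_level_gt_1)+
  then show ?case
    unfolding step using Suc.IH[folded a_def] nn by (cases ?miss) auto
qed

text \<open>The distances from \<alpha> to the ends of the confining interval are
  \<open>\<alpha> + \<gamma> * (1 - \<alpha>)\<close> and
  \<open>1 - \<alpha> + \<gamma> * \<alpha>\<close>; both overshoots are bounded by
  \<gamma>.\<close>

lemma abs_wtqa_level_diff_le:
  assumes "0 \<le> \<alpha>" "\<alpha> \<le> 1" "\<gamma> > 0"
  shows "\<bar>wtqa_level N s \<alpha> h \<gamma> x y r t - \<alpha>\<bar> \<le> max \<alpha> (1 - \<alpha>) + \<gamma>"
proof -
  have "\<gamma> * (1 - \<alpha>) \<le> \<gamma>" "\<gamma> * \<alpha> \<le> \<gamma>"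
    using assms by (simp_all add: mult_left_le)
  then show ?thesis
    using wtqa_level_bounds[OF assms, of N s h x y r t] by (auto simp: abs_le_iff)
qed

section \<open>Measurability of the coverage event\<close>

text \<open>The cumulative weight is monotone in the threshold, so it suffices to test rational
  thresholds; this makes coverage a countable intersection of measurable events.\<close>

lemma mem_set_at_level_iff:
  "z \<in> set_at_level N s h x y a t v \<longleftrightarrow>
    (\<forall>q::rat. of_rat q < s (v, z) \<longrightarrow>
      (\<Sum>k = 1..N + 1. weight N h x t k * of_bool (padded_score N s x y t k \<le> ereal (of_rat q))) < 1 - a)"
proof -
  define F where
    "F q = (\<Sum>k = 1..N + 1. weight N h x t k * of_bool (padded_score N s x y t k \<le> q))" for q
  have mono: "F q \<le> F q'" if "q \<le> q'" for q q'
    unfolding F_def using that by (intro sum_mono mult_left_mono weight_nonneg) auto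
  have "z \<in> set_at_level N s h x y a t v \<longleftrightarrow> (\<forall>q. F q \<ge> 1 - a \<longrightarrow> ereal (s (v, z)) \<le> q)"
    unfolding set_at_level_def threshold_def F_def by (simp add: le_Inf_iff del: sum.cl_ivl_Suc)
  also have "\<dots> \<longleftrightarrow> (\<forall>q::rat. of_rat q < s (v, z) \<longrightarrow> F (ereal (of_rat q)) < 1 - a)"
  proof (intro iffI allI impI)
    fix q :: rat
    assume "\<forall>q. F q \<ge> 1 - a \<longrightarrow> ereal (s (v, z)) \<le> q" and "of_rat q < s (v, z)"
    then show "F (ereal (of_rat q)) < 1 - a"
      by (metis ereal_less_eq(3) linorder_not_le)
  next
    fix q
    assume *: "\<forall>q::rat. of_rat q < s (v, z) \<longrightarrow> F (ereal (of_rat q)) < 1 - a" and q: "F q \<ge> 1 - a"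
    show "ereal (s (v, z)) \<le> q"
    proof (rule ccontr)
      assume "\<not> ereal (s (v, z)) \<le> q"
      then have "q < ereal (s (v, z))" by simp
      \<comment> \<open>Since \<open>q\<close> may be minus infinity, a real \<open>u\<close> is
        inserted first; only then does density of the rationals in the reals apply.\<close>
      then obtain u where u: "q < ereal u" "ereal u < ereal (s (v, z))"
        by (metis ereal_dense2)
      then obtain q' :: rat where q': "u < of_rat q'" "of_rat q' < s (v, z)"
        using of_rat_dense by auto
      then have "q \<le> ereal (of_rat q')"
        using u by (meson ereal_less_eq(3) less_imp_le order_trans)
      then show False using mono[of q "ereal (of_rat q')"] * q q' by force
    qed
  qed
  finally show ?thesis unfolding F_def .
qed

lemma borel_measurable_feature_mean:
  fixes X :: "nat \<Rightarrow> nat \<Rightarrow> 'w \<Rightarrow> real ^ 'd"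
  assumes "\<And>u. u \<in> {1..t} \<Longrightarrow> X k u \<in> borel_measurable G"
  shows "(\<lambda>\<omega>. feature_mean (\<lambda>k u. X k u \<omega>) k t) \<in> borel_measurable G"
  unfolding feature_mean_def
  by (intro borel_measurable_scaleR borel_measurable_const borel_measurable_sum assms)

lemma borel_measurable_affinity:
  fixes X :: "nat \<Rightarrow> nat \<Rightarrow> 'w \<Rightarrow> real ^ 'd"
  assumes "\<And>k u. k \<in> {1..N + 1} \<Longrightarrow> u \<in> {1..t} \<Longrightarrow> X k u \<in> borel_measurable G"
    and "k \<in> {1..N + 1}"
  shows "(\<lambda>\<omega>. affinity N h (\<lambda>k u. X k u \<omega>) k t) \<in> borel_measurable G"
proof -
  have [measurable]: "(\<lambda>\<omega>. feature_mean (\<lambda>k u. X k u \<omega>) j t) \<in> borel_measurable G"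
    if "j \<in> {1..N + 1}" for j
    using assms(1) that by (intro borel_measurable_feature_mean) auto
  have "(\<lambda>\<omega>. feature_mean (\<lambda>k u. X k u \<omega>) k t) \<in> borel_measurable G"
    "(\<lambda>\<omega>. feature_mean (\<lambda>k u. X k u \<omega>) (N + 1) t) \<in> borel_measurable G"
    using assms(2) by auto
  note [measurable] = this
  show ?thesis unfolding affinity_def by measurable
qed

lemma borel_measurable_weight:
  fixes X :: "nat \<Rightarrow> nat \<Rightarrow> 'w \<Rightarrow> real ^ 'd"
  assumes "\<And>k u. k \<in> {1..N + 1} \<Longrightarrow> u \<in> {1..t} \<Longrightarrow> X k u \<in> borel_measurable G"
    and "k \<in> {1..N + 1}"
  shows "(\<lambda>\<omega>. weight N h (\<lambda>k u. X k u \<omega>) t k) \<in> borel_measurable G"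
proof -
  have "(\<lambda>\<omega>. affinity N h (\<lambda>k u. X k u \<omega>) j (t - 1)) \<in> borel_measurable G"
    if "j \<in> {1..N + 1}" for j
    using assms(1) that by (intro borel_measurable_affinity) auto
  then show ?thesis
    unfolding weight_def using assms(2)
    by (cases "t \<le> 1") (auto simp del: sum.cl_ivl_Suc intro!: borel_measurable_divide borel_measurable_sum)
qed

text \<open>The algebra \<open>G\<close>, the level \<open>a\<close> and the tested value
  \<open>z\<close> are left abstract because the lemma is used twice: with the delayed feedback
  \<open>R t * Y (N + 1) t\<close> over the observed history, and with the response itself over the
  algebra enlarged by it. The target score enters the weighted sum only as infinity, so
  \<open>Y\<close> is constrained on calibration units alone.\<close>

lemma pred_mem_set_at_level:
  fixes X :: "nat \<Rightarrow> nat \<Rightarrow> 'w \<Rightarrow> real ^ 'd"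
  assumes X: "\<And>k u. k \<in> {1..N + 1} \<Longrightarrow> u \<in> {1..t} \<Longrightarrow> X k u \<in> borel_measurable G"
    and Y: "\<And>k. k \<in> {1..N} \<Longrightarrow> Y k t \<in> borel_measurable G"
    and s [measurable]: "s \<in> borel_measurable borel"
    and a [measurable]: "a \<in> borel_measurable G"
    and z [measurable]: "z \<in> borel_measurable G"
    and t: "t \<ge> 1"
  shows "Measurable.pred G (\<lambda>\<omega>. z \<omega> \<in>
    set_at_level N s h (\<lambda>k u. X k u \<omega>) (\<lambda>k u. Y k u \<omega>) (a \<omega>) t (X (N + 1) t \<omega>))"
proof -
  have [measurable]: "(\<lambda>\<omega>. s (X (N + 1) t \<omega>, z \<omega>)) \<in> borel_measurable G"
  proof -
    have [measurable]: "X (N + 1) t \<in> borel_measurable G" using X t by auto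
    show ?thesis by measurable
  qed
  have "Measurable.pred G
      (\<lambda>\<omega>. padded_score N s (\<lambda>k u. X k u \<omega>) (\<lambda>k u. Y k u \<omega>) t k \<le> ereal c)"
    if k: "k \<in> {1..N + 1}" for k c
  proof (cases "k = N + 1")
    case True
    then show ?thesis by (simp add: padded_score_def)
  next
    case False
    then have [measurable]: "X k t \<in> borel_measurable G" "Y k t \<in> borel_measurable G"
      using X Y t k by auto
    show ?thesis using False by (simp add: padded_score_def)
  qed
  then have [measurable]: "(\<lambda>\<omega>. \<Sum>k = 1..N + 1. weight N h (\<lambda>k u. X k u \<omega>) t k *
      of_bool (padded_score N s (\<lambda>k u. X k u \<omega>) (\<lambda>k u. Y k u \<omega>) t k \<le> ereal c)) \<in> borel_measurable G" for c
    unfolding of_bool_def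
    by (intro borel_measurable_sum borel_measurable_times borel_measurable_weight X
        measurable_If borel_measurable_const) (auto simp: pred_def)
  show ?thesis unfolding mem_set_at_level_iff by measurable
qed

section \<open>The observation and outcome algebras\<close>

lemma sets_obs_algebra:
  "sets (obs_algebra M N X Y R t) = sigma_sets (space M)
    (\<Union>u\<in>{1..t}. sets (vimage_algebra (space M) (batch N X Y R u) (batch_space N)))"
  unfolding obs_algebra_def
  by (rule sets_measure_of) (use sets.sets_into_space in fastforce)

lemma space_obs_algebra [simp]: "space (obs_algebra M N X Y R t) = space M"
  by (simp add: obs_algebra_def space_measure_of_conv)

lemma space_outcome_algebra [simp]: "space (outcome_algebra M N X Y R t) = space M"
  by (simp add: outcome_algebra_def space_measure_of_conv)

lemma sets_outcome_algebra:
  "sets (outcome_algebra M N X Y R t) = sigma_sets (space M)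
    (sets (obs_algebra M N X Y R t) \<union> sets (vimage_algebra (space M) (Y (N + 1) t) borel))"
  unfolding outcome_algebra_def
  by (rule sets_measure_of)
    (use sets.sets_into_space[where M="obs_algebra M N X Y R t"] sets.sets_into_space in fastforce)

text \<open>The calibration block is a restricted function, hence extensional, as membership in the
  product space over \<open>{1..N}\<close> demands.\<close>

lemma batch_in_space: "batch N X Y R u \<omega> \<in> space (batch_space N)"
  by (auto simp: batch_def batch_space_def space_pair_measure space_PiM)

lemma measurable_batch:
  fixes X :: "nat \<Rightarrow> nat \<Rightarrow> 'w \<Rightarrow> real ^ 'd"
  assumes "u \<in> {1..t}"
  shows "batch N X Y R u \<in> measurable (obs_algebra M N X Y R t) (batch_space N)"
proof (rule measurableI)
  fix A :: "((nat \<Rightarrow> (real ^ 'd) \<times> real) \<times> (real ^ 'd) \<times> real \<times> real) set"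
  assume "A \<in> sets (batch_space N)"
  then have "batch N X Y R u -` A \<inter> space M
      \<in> sets (vimage_algebra (space M) (batch N X Y R u) (batch_space N))"
    by (rule in_vimage_algebra)
  then show "batch N X Y R u -` A \<inter> space (obs_algebra M N X Y R t) \<in> sets (obs_algebra M N X Y R t)"
    unfolding sets_obs_algebra space_obs_algebra using assms by (intro sigma_sets.Basic) blast
qed (rule batch_in_space)

text \<open>All four facts are projections of the batch map. The target response appears only
  multiplied by its indicator and one round late, whence the index \<open>u - 1\<close>.\<close>

lemma
  fixes X :: "nat \<Rightarrow> nat \<Rightarrow> 'w \<Rightarrow> real ^ 'd"
  assumes u: "u \<in> {1..t}"
  shows obs_measurable_X: "k \<in> {1..N + 1} \<Longrightarrow> X k u \<in> borel_measurable (obs_algebra M N X Y R t)"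
    and obs_measurable_Y: "k \<in> {1..N} \<Longrightarrow> Y k u \<in> borel_measurable (obs_algebra M N X Y R t)"
    and obs_measurable_R: "R (u - 1) \<in> borel_measurable (obs_algebra M N X Y R t)"
    and obs_measurable_RY:
      "(\<lambda>\<omega>. R (u - 1) \<omega> * Y (N + 1) (u - 1) \<omega>) \<in> borel_measurable (obs_algebra M N X Y R t)"
proof -
  let ?G = "obs_algebra M N X Y R t"
  note b [measurable] = measurable_batch[OF u, of N X Y R M, unfolded batch_space_def]
  have 1: "(\<lambda>\<omega>. fst (batch N X Y R u \<omega>)) \<in> measurable ?G (\<Pi>\<^sub>M i\<in>{1..N}. borel)"
    and 2: "(\<lambda>\<omega>. fst (snd (batch N X Y R u \<omega>))) \<in> borel_measurable ?G"
    and 3: "(\<lambda>\<omega>. fst (snd (snd (batch N X Y R u \<omega>)))) \<in> borel_measurable ?G"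
    and 4: "(\<lambda>\<omega>. snd (snd (snd (batch N X Y R u \<omega>)))) \<in> borel_measurable ?G"
    by measurable
  have pair: "(\<lambda>\<omega>. (X k u \<omega>, Y k u \<omega>)) \<in> borel_measurable ?G" if "k \<in> {1..N}" for k
    using measurable_compose[OF 1 measurable_component_singleton[OF that]] that
    by (simp add: batch_def)
  show "R (u - 1) \<in> borel_measurable ?G"
    "(\<lambda>\<omega>. R (u - 1) \<omega> * Y (N + 1) (u - 1) \<omega>) \<in> borel_measurable ?G"
    using 3 4 by (simp_all add: batch_def)
  show "X k u \<in> borel_measurable ?G" if "k \<in> {1..N + 1}"
  proof (cases "k = N + 1")
    case True
    then show ?thesis using 2 by (simp add: batch_def)
  next
    case False
    then have [measurable]: "(\<lambda>\<omega>. (X k u \<omega>, Y k u \<omega>)) \<in> measurable ?G (borel \<Otimes>\<^sub>M borel)"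
      using that pair[of k] by (simp add: borel_prod)
    have "(\<lambda>\<omega>. fst (X k u \<omega>, Y k u \<omega>)) \<in> borel_measurable ?G" by measurable
    then show ?thesis by simp
  qed
  show "Y k u \<in> borel_measurable ?G" if "k \<in> {1..N}"
  proof -
    have [measurable]: "(\<lambda>\<omega>. (X k u \<omega>, Y k u \<omega>)) \<in> measurable ?G (borel \<Otimes>\<^sub>M borel)"
      using that pair[of k] by (simp add: borel_prod)
    have "(\<lambda>\<omega>. snd (X k u \<omega>, Y k u \<omega>)) \<in> borel_measurable ?G" by measurable
    then show ?thesis by simp
  qed
qed

section \<open>Adaptedness of the level and of the miscoverage event\<close>

lemma sets_obs_algebra_mono:
  "t \<le> t' \<Longrightarrow> sets (obs_algebra M N X Y R t) \<subseteq> sets (obs_algebra M N X Y R t')"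
  unfolding sets_obs_algebra by (rule sigma_sets_mono') fastforce

lemma obs_measurable_mono:
  assumes "f \<in> measurable (obs_algebra M N X Y R t) A" "t \<le> t'"
  shows "f \<in> measurable (obs_algebra M N X Y R t') A"
  using assms sets_obs_algebra_mono[OF assms(2), of M N X Y R] unfolding measurable_def by auto

text \<open>The update to round \<open>Suc t\<close> consults the response of round \<open>t\<close>
  only when \<open>R t = 1\<close>. There it equals \<open>R t * Y (N + 1) t\<close>, which belongs
  to the batch of round \<open>Suc t\<close>, so the recursion can be rewritten in observed
  quantities.\<close>

lemma obs_measurable_level:
  fixes X :: "nat \<Rightarrow> nat \<Rightarrow> 'w \<Rightarrow> real ^ 'd"
  assumes s: "s \<in> borel_measurable borel"
    and R0: "\<And>\<omega>. \<omega> \<in> space M \<Longrightarrow> R 0 \<omega> = 0"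
  shows "(\<lambda>\<omega>. wtqa_level N s \<alpha> h \<gamma> (\<lambda>k u. X k u \<omega>) (\<lambda>k u. Y k u \<omega>) (\<lambda>u. R u \<omega>) t)
    \<in> borel_measurable (obs_algebra M N X Y R t)"
proof (induction t)
  case 0
  show ?case by simp
next
  case (Suc t)
  let ?G = "obs_algebra M N X Y R (Suc t)"
  define a where "a \<omega> = wtqa_level N s \<alpha> h \<gamma> (\<lambda>k u. X k u \<omega>) (\<lambda>k u. Y k u \<omega>) (\<lambda>u. R u \<omega>) t" for \<omega>
  have a [measurable]: "a \<in> borel_measurable ?G"
    unfolding a_def by (rule obs_measurable_mono[OF Suc.IH]) simp
  show ?case
  proof (cases "t = 0")
    \<comment> \<open>The set at round 0 is never consulted: \<open>R 0 = 0\<close> blocks the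
      update, so the level at round 1 is the constant \<alpha>.\<close>
    case True
    then have "wtqa_level N s \<alpha> h \<gamma> (\<lambda>k u. X k u \<omega>) (\<lambda>k u. Y k u \<omega>) (\<lambda>u. R u \<omega>) (Suc t) = \<alpha>"
      if "\<omega> \<in> space ?G" for \<omega>
      using that R0 by simp
    then show ?thesis by (subst measurable_cong) auto
  next
    case False
    have [measurable]: "R t \<in> borel_measurable ?G"
      using obs_measurable_R[of "Suc t" "Suc t" R M N X Y] by simp
    have RY [measurable]: "(\<lambda>\<omega>. R t \<omega> * Y (N + 1) t \<omega>) \<in> borel_measurable ?G"
      using obs_measurable_RY[of "Suc t" "Suc t" R Y N M X] by simp
    have [measurable]: "Measurable.pred ?G (\<lambda>\<omega>. R t \<omega> * Y (N + 1) t \<omega> \<in>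
      set_at_level N s h (\<lambda>k u. X k u \<omega>) (\<lambda>k u. Y k u \<omega>) (a \<omega>) t (X (N + 1) t \<omega>))"
      using False
      by (intro pred_mem_set_at_level s a RY obs_measurable_X obs_measurable_Y) auto
    have "(\<lambda>\<omega>. if R t \<omega> = 1 then a \<omega> + \<gamma> * (\<alpha> - of_bool (R t \<omega> * Y (N + 1) t \<omega> \<notin>
      set_at_level N s h (\<lambda>k u. X k u \<omega>) (\<lambda>k u. Y k u \<omega>) (a \<omega>) t (X (N + 1) t \<omega>))) else a \<omega>)
      \<in> borel_measurable ?G"
      unfolding of_bool_def by measurable
    also have "(\<lambda>\<omega>. if R t \<omega> = 1 then a \<omega> + \<gamma> * (\<alpha> - of_bool (R t \<omega> * Y (N + 1) t \<omega> \<notin>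
      set_at_level N s h (\<lambda>k u. X k u \<omega>) (\<lambda>k u. Y k u \<omega>) (a \<omega>) t (X (N + 1) t \<omega>))) else a \<omega>)
      = (\<lambda>\<omega>. wtqa_level N s \<alpha> h \<gamma> (\<lambda>k u. X k u \<omega>) (\<lambda>k u. Y k u \<omega>) (\<lambda>u. R u \<omega>) (Suc t))"
      by (auto simp: a_def fun_eq_iff)
    finally show ?thesis .
  qed
qed

lemma sets_obs_le_outcome:
  "sets (obs_algebra M N X Y R t) \<subseteq> sets (outcome_algebra M N X Y R t)"
  unfolding sets_outcome_algebra by auto

lemma outcome_measurableI:
  assumes "f \<in> measurable (obs_algebra M N X Y R t) A"
  shows "f \<in> measurable (outcome_algebra M N X Y R t) A"
  using assms sets_obs_le_outcome[of M N X Y R t] unfolding measurable_def by auto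

lemma outcome_measurable_Y: "Y (N + 1) t \<in> borel_measurable (outcome_algebra M N X Y R t)"
proof (rule measurableI)
  fix A :: "real set" assume "A \<in> sets borel"
  then have "Y (N + 1) t -` A \<inter> space M \<in> sets (vimage_algebra (space M) (Y (N + 1) t) borel)"
    by (rule in_vimage_algebra)
  then show "Y (N + 1) t -` A \<inter> space (outcome_algebra M N X Y R t)
      \<in> sets (outcome_algebra M N X Y R t)"
    unfolding sets_outcome_algebra space_outcome_algebra by (intro sigma_sets.Basic) simp
qed simp

text \<open>The level, weights and calibration scores are known from the history up to round
  \<open>t\<close>; adjoining the current target response is exactly what decides coverage. The
  indicator \<open>R t\<close> is not among the generators, so the missingness assumption can be
  applied conditionally on this event.\<close>

lemma outcome_measurable_covered:
  fixes X :: "nat \<Rightarrow> nat \<Rightarrow> 'w \<Rightarrow> real ^ 'd"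
  assumes s: "s \<in> borel_measurable borel"
    and R0: "\<And>\<omega>. \<omega> \<in> space M \<Longrightarrow> R 0 \<omega> = 0"
    and t: "t \<ge> 1"
  shows "Measurable.pred (outcome_algebra M N X Y R t) (\<lambda>\<omega>. Y (N + 1) t \<omega> \<in>
    wtqa_set N s \<alpha> h \<gamma> (\<lambda>k u. X k u \<omega>) (\<lambda>k u. Y k u \<omega>) (\<lambda>u. R u \<omega>) t (X (N + 1) t \<omega>))"
  unfolding wtqa_set_def using t
  by (intro pred_mem_set_at_level s outcome_measurable_Y
      outcome_measurableI[OF obs_measurable_level[OF s]] R0
      outcome_measurableI[OF obs_measurable_X] outcome_measurableI[OF obs_measurable_Y]) auto

lemma subalgebra_outcome:
  fixes X :: "nat \<Rightarrow> nat \<Rightarrow> 'w \<Rightarrow> real ^ 'd"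
  assumes X: "\<And>i t. i \<in> {1..N + 1} \<Longrightarrow> t \<ge> 1 \<Longrightarrow> X i t \<in> borel_measurable M"
    and Y: "\<And>i t. i \<in> {1..N + 1} \<Longrightarrow> t \<ge> 1 \<Longrightarrow> Y i t \<in> borel_measurable M"
    and R: "\<And>t. t \<ge> 1 \<Longrightarrow> R t \<in> borel_measurable M"
    and R0: "\<And>\<omega>. \<omega> \<in> space M \<Longrightarrow> R 0 \<omega> = 0"
    and t: "t \<ge> 1"
  shows "subalgebra M (outcome_algebra M N X Y R t)"
proof -
  \<comment> \<open>The first batch contains the round 0 feedback, whereas measurability is assumed
    from round 1 on. Both \<open>R 0\<close> and the product \<open>R 0 * Y (N + 1) 0\<close> are
    constantly 0 on the space.\<close>
  have R': "R u \<in> borel_measurable M" for u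
  proof (cases "u = 0")
    case True
    have "R 0 \<in> borel_measurable M \<longleftrightarrow> (\<lambda>_. 0 :: real) \<in> borel_measurable M"
      by (rule measurable_cong) (simp add: R0)
    then show ?thesis using True by simp
  qed (simp add: R)
  have RY: "(\<lambda>\<omega>. R u \<omega> * Y (N + 1) u \<omega>) \<in> borel_measurable M" for u
  proof (cases "u = 0")
    case True
    have "(\<lambda>\<omega>. R 0 \<omega> * Y (N + 1) 0 \<omega>) \<in> borel_measurable M \<longleftrightarrow> (\<lambda>_. 0 :: real) \<in> borel_measurable M"
      by (rule measurable_cong) (simp add: R0)
    then show ?thesis using True by simp
  next
    case False
    then show ?thesis by (intro borel_measurable_times R' Y) auto
  qed
  have pair: "(\<lambda>\<omega>. (X i u \<omega>, Y i u \<omega>)) \<in> borel_measurable M" if "i \<in> {1..N}" "u \<ge> 1" for i u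
    using that by (intro borel_measurable_Pair X Y) auto
  have batch: "batch N X Y R u \<in> measurable M (batch_space N)" if "u \<ge> 1" for u
    unfolding batch_def[abs_def] batch_space_def
    using that by (intro measurable_Pair measurable_restrict pair X RY R') auto
  have obs: "sets (obs_algebra M N X Y R t) \<subseteq> sets M"
    unfolding sets_obs_algebra
  proof (intro sets.sigma_sets_subset UN_least)
    fix u assume "u \<in> {1..t}"
    then show "sets (vimage_algebra (space M) (batch N X Y R u) (batch_space N)) \<subseteq> sets M"
      using measurable_sets[OF batch[of u]] batch_in_space[of N X Y R u]
      by (auto simp: sets_vimage_algebra2)
  qed
  have "sets (vimage_algebra (space M) (Y (N + 1) t) borel) \<subseteq> sets M"
    using measurable_sets[OF Y[of "N + 1" t]] t by (auto simp: sets_vimage_algebra2)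
  with obs have "sets (outcome_algebra M N X Y R t) \<subseteq> sets M"
    unfolding sets_outcome_algebra by (intro sets.sigma_sets_subset) simp
  then show ?thesis by (simp add: subalgebra_def)
qed

section \<open>Conditional expectation and telescoping\<close>

text \<open>The pull-out property: \<open>f\<close> is measurable for the conditioning algebra, so
  the indicator of \<open>A\<close> may be replaced under the integral by its conditional
  expectation, here almost surely the constant \<open>p\<close>. Boundedness of \<open>f\<close>
  supplies integrability.\<close>

lemma (in prob_space) integral_indicator_times_cond_const:
  fixes f :: "'a \<Rightarrow> real"
  assumes sub: "subalgebra M F"
    and f: "f \<in> borel_measurable F"
    and bound: "\<And>\<omega>. \<omega> \<in> space M \<Longrightarrow> \<bar>f \<omega>\<bar> \<le> B"
    and A: "A \<in> sets M"
    and cond: "AE \<omega> in M. real_cond_exp M F (indicator A) \<omega> = p"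
  shows "(\<integral>\<omega>. f \<omega> * indicator A \<omega> \<partial>M) = p * (\<integral>\<omega>. f \<omega> \<partial>M)"
proof -
  interpret sigma_finite_subalgebra M F
    by (rule finite_measure_subalgebra_is_sigma_finite) (unfold_locales, rule sub)
  have fM [measurable]: "f \<in> borel_measurable M"
    using measurable_from_subalg[OF sub f] .
  have "integrable M f"
    by (rule integrable_const_bound[of _ B]) (use bound in auto)
  then have int: "integrable M (\<lambda>\<omega>. f \<omega> * indicator A \<omega>)"
    using A by (rule integrable_real_mult_indicator[rotated])
  have "(\<integral>\<omega>. f \<omega> * indicator A \<omega> \<partial>M) = (\<integral>\<omega>. f \<omega> * real_cond_exp M F (indicator A) \<omega> \<partial>M)"
    by (rule real_cond_exp_intg(2)[symmetric]) (use int f A in auto)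
  also have "\<dots> = (\<integral>\<omega>. f \<omega> * p \<partial>M)"
    by (rule integral_cong_AE) (use cond in auto)
  finally show ?thesis by simp
qed

text \<open>The update telescopes. Feedback from round \<open>T\<close> acts on the level of round
  \<open>Suc T\<close>, and \<open>r 0 = 0\<close> keeps the level at \<alpha> through round 1, so
  the sum runs over exactly \<open>1..T\<close>.\<close>

lemma wtqa_level_eq_sum:
  assumes "\<And>u. r u \<in> {0, 1}" "r 0 = 0"
  shows "wtqa_level N s \<alpha> h \<gamma> x y r (Suc T) - \<alpha> =
    \<gamma> * (\<Sum>t = 1..T. (\<alpha> - of_bool (y (N + 1) t \<notin> wtqa_set N s \<alpha> h \<gamma> x y r t (x (N + 1) t)))
      * of_bool (r t = 1))"
proof (induction T)
  case 0
  then show ?case using assms(2) by simp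
next
  case (Suc T)
  have "wtqa_level N s \<alpha> h \<gamma> x y r (Suc (Suc T)) =
    wtqa_level N s \<alpha> h \<gamma> x y r (Suc T) + \<gamma> * ((\<alpha> - of_bool (y (N + 1) (Suc T)
      \<notin> wtqa_set N s \<alpha> h \<gamma> x y r (Suc T) (x (N + 1) (Suc T)))) * of_bool (r (Suc T) = 1))"
    unfolding wtqa_set_def by (subst wtqa_level.simps(2)) (simp del: wtqa_level.simps)
  then show ?case using Suc.IH by (simp add: algebra_simps del: wtqa_level.simps)
qed

theorem theorem5p6:
  fixes M :: "'w measure"
    and N :: nat
    and X :: "nat \<Rightarrow> nat \<Rightarrow> 'w \<Rightarrow> real ^ 'd"
    and Y :: "nat \<Rightarrow> nat \<Rightarrow> 'w \<Rightarrow> real"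
    and R :: "nat \<Rightarrow> 'w \<Rightarrow> real"
    and s :: "(real ^ 'd) \<times> real \<Rightarrow> real"
    and \<alpha> h \<gamma> p :: real
  assumes "prob_space M"
    and "N \<ge> 1"
    and "\<And>i t. i \<in> {1..N + 1} \<Longrightarrow> t \<ge> 1 \<Longrightarrow> X i t \<in> borel_measurable M"
    and "\<And>i t. i \<in> {1..N + 1} \<Longrightarrow> t \<ge> 1 \<Longrightarrow> Y i t \<in> borel_measurable M"
    and "\<And>t. t \<ge> 1 \<Longrightarrow> R t \<in> borel_measurable M"
    and "\<And>t \<omega>. t \<ge> 1 \<Longrightarrow> \<omega> \<in> space M \<Longrightarrow> R t \<omega> \<in> {0, 1}"
    and "\<And>\<omega>. \<omega> \<in> space M \<Longrightarrow> R 0 \<omega> = 0"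
    and "\<And>\<omega>. \<omega> \<in> space M \<Longrightarrow> Y (N + 1) 0 \<omega> = 0"
    and "s \<in> borel_measurable borel"
    and "0 \<le> \<alpha>" "\<alpha> \<le> 1" "h > 0" "\<gamma> > 0"
    and "0 < p" "p \<le> 1"
    and "\<And>t. t \<ge> 1 \<Longrightarrow>
           AE \<omega> in M. real_cond_exp M (outcome_algebra M N X Y R t)
             (indicator {\<omega>' \<in> space M. R t \<omega>' = 1}) \<omega> = p"
  shows "(\<forall>T::nat. T \<ge> 1 \<longrightarrow>
            \<bar>1 / real T * (\<Sum>t = 1..T. miscoverage_prob M N s \<alpha> h \<gamma> X Y R t) - \<alpha>\<bar>
              \<le> (max \<alpha> (1 - \<alpha>) + \<gamma>) / (p * real T * \<gamma>))
       \<and> (\<lambda>T::nat. 1 / real T * (\<Sum>t = 1..T. miscoverage_prob M N s \<alpha> h \<gamma> X Y R t)) \<longlonglongrightarrow> \<alpha>"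
proof -
  interpret prob_space M by fact
  define miss where "miss t = {\<omega> \<in> space M. Y (N + 1) t \<omega> \<notin>
    wtqa_set N s \<alpha> h \<gamma> (\<lambda>k u. X k u \<omega>) (\<lambda>k u. Y k u \<omega>) (\<lambda>u. R u \<omega>) t (X (N + 1) t \<omega>)}" for t
  define m where "m t = miscoverage_prob M N s \<alpha> h \<gamma> X Y R t" for t
  have m_eq: "m t = prob (miss t)" for t
    by (simp add: m_def miss_def miscoverage_prob_def)
  define reveal where "reveal t = {\<omega> \<in> space M. R t \<omega> = 1}" for t
  \<comment> \<open>The centred loss \<open>\<alpha> - \<ell>\<close> of round \<open>t\<close>;
    multiplied by the indicator of \<open>reveal t\<close> and by \<gamma> it is the increment of
    the level.\<close>
  define g where "g t \<omega> = \<alpha> - indicator (miss t) \<omega>" for t \<omega>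
  let ?B = "max \<alpha> (1 - \<alpha>) + \<gamma>"
  have sub: "subalgebra M (outcome_algebra M N X Y R t)" if "t \<ge> 1" for t
    by (rule subalgebra_outcome) (use assms that in auto)
  have missF: "miss t \<in> sets (outcome_algebra M N X Y R t)" if "t \<ge> 1" for t
  proof -
    have "Measurable.pred (outcome_algebra M N X Y R t) (\<lambda>\<omega>. Y (N + 1) t \<omega> \<notin>
      wtqa_set N s \<alpha> h \<gamma> (\<lambda>k u. X k u \<omega>) (\<lambda>k u. Y k u \<omega>) (\<lambda>u. R u \<omega>) t (X (N + 1) t \<omega>))"
      by (intro pred_intros_logic outcome_measurable_covered) (use assms that in auto)
    then show ?thesis by (simp add: pred_def miss_def)
  qed
  have miss: "miss t \<in> sets M" if "t \<ge> 1" for t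
    using sub[OF that] missF[OF that] by (auto simp: subalgebra_def)
  have reveal: "reveal t \<in> sets M" if "t \<ge> 1" for t
  proof -
    have [measurable]: "R t \<in> borel_measurable M" using assms that by blast
    show ?thesis unfolding reveal_def by measurable
  qed
  have gM: "integrable M (g t)" if "t \<ge> 1" for t
    unfolding g_def using miss[OF that] by (auto simp: less_top[symmetric])
  have int: "integrable M (\<lambda>\<omega>. g t \<omega> * indicator (reveal t) \<omega>)" if "t \<ge> 1" for t
    using reveal[OF that] gM[OF that] by (rule integrable_real_mult_indicator)
  \<comment> \<open>Missingness given the history and the current response turns the observed
    increment into \<open>p\<close> times the full miscoverage gap, even though \<open>g t\<close>
    depends on past feedback.\<close>
  have exp_step: "(\<integral>\<omega>. g t \<omega> * indicator (reveal t) \<omega> \<partial>M) = p * (\<alpha> - m t)" if t: "t \<ge> 1" for t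
  proof -
    have "(\<integral>\<omega>. g t \<omega> * indicator (reveal t) \<omega> \<partial>M) = p * (\<integral>\<omega>. g t \<omega> \<partial>M)"
    proof (rule integral_indicator_times_cond_const[OF sub[OF t], where B=1])
      show "g t \<in> borel_measurable (outcome_algebra M N X Y R t)"
        unfolding g_def using missF[OF t] by simp
      show "\<bar>g t \<omega>\<bar> \<le> 1" for \<omega>
        using assms(10,11) by (auto simp: g_def indicator_def)
      show "AE \<omega> in M. real_cond_exp M (outcome_algebra M N X Y R t) (indicator (reveal t)) \<omega> = p"
        unfolding reveal_def using assms t by blast
    qed (rule reveal[OF t])
    also have "(\<integral>\<omega>. g t \<omega> \<partial>M) = \<alpha> - m t"
      unfolding g_def m_eq using miss[OF t]
      by (subst Bochner_Integration.integral_diff) (auto simp: prob_space less_top[symmetric])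
    finally show ?thesis .
  qed
  \<comment> \<open>The sum is the final level minus \<alpha>, so its bound is independent of
    \<open>T\<close> and holds at every point of the space.\<close>
  have path: "\<bar>\<gamma> * (\<Sum>t = 1..T. g t \<omega> * indicator (reveal t) \<omega>)\<bar> \<le> ?B" if \<omega>: "\<omega> \<in> space M" for \<omega> T
  proof -
    have "R u \<omega> \<in> {0, 1}" for u
      using assms(6)[of u \<omega>] assms(7)[OF \<omega>] \<omega> by (cases "u = 0") auto
    from wtqa_level_eq_sum[of "\<lambda>u. R u \<omega>" N s \<alpha> h \<gamma> "\<lambda>k u. X k u \<omega>" "\<lambda>k u. Y k u \<omega>" T, OF this]
    have eq: "\<gamma> * (\<Sum>t = 1..T. g t \<omega> * indicator (reveal t) \<omega>) =
      wtqa_level N s \<alpha> h \<gamma> (\<lambda>k u. X k u \<omega>) (\<lambda>k u. Y k u \<omega>) (\<lambda>u. R u \<omega>) (Suc T) - \<alpha>"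
      using \<omega> assms(7) by (simp add: g_def miss_def reveal_def indicator_def of_bool_def)
    show ?thesis
      unfolding eq by (rule abs_wtqa_level_diff_le[OF assms(10,11,13)])
  qed
  \<comment> \<open>Integrating the pathwise bound over a probability space keeps the same
    constant.\<close>
  have total: "\<bar>\<gamma> * (\<Sum>t = 1..T. p * (\<alpha> - m t))\<bar> \<le> ?B" for T
  proof -
    let ?S = "\<lambda>\<omega>. \<gamma> * (\<Sum>t = 1..T. g t \<omega> * indicator (reveal t) \<omega>)"
    have S: "integrable M ?S"
      using int by (intro integrable_mult_right Bochner_Integration.integrable_sum) auto
    have "(\<integral>\<omega>. ?S \<omega> \<partial>M) = \<gamma> * (\<Sum>t = 1..T. p * (\<alpha> - m t))"
    proof -
      have "(\<integral>\<omega>. ?S \<omega> \<partial>M) = \<gamma> * (\<Sum>t = 1..T. \<integral>\<omega>. g t \<omega> * indicator (reveal t) \<omega> \<partial>M)"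
        unfolding integral_mult_right_zero
        by (subst Bochner_Integration.integral_sum) (use int in auto)
      also have "(\<Sum>t = 1..T. \<integral>\<omega>. g t \<omega> * indicator (reveal t) \<omega> \<partial>M) = (\<Sum>t = 1..T. p * (\<alpha> - m t))"
        by (intro sum.cong exp_step) auto
      finally show ?thesis .
    qed
    moreover have "\<bar>\<integral>\<omega>. ?S \<omega> \<partial>M\<bar> \<le> (\<integral>\<omega>. \<bar>?S \<omega>\<bar> \<partial>M)"
      by (rule integral_abs_bound)
    moreover have "(\<integral>\<omega>. \<bar>?S \<omega>\<bar> \<partial>M) \<le> ?B"
      using S path by (intro integral_le_const integrable_abs AE_I2) auto
    ultimately show ?thesis by linarith
  qed
  have main: "\<bar>1 / real T * (\<Sum>t = 1..T. m t) - \<alpha>\<bar> \<le> ?B / (p * real T * \<gamma>)" if "T \<ge> 1" for T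
  proof -
    have pos: "p * real T * \<gamma> > 0" using assms that by simp
    have eq: "(\<Sum>t = 1..T. p * (\<alpha> - m t)) = p * (real T * \<alpha> - (\<Sum>t = 1..T. m t))"
      by (simp add: sum_distrib_left[symmetric] sum_subtractf)
    \<comment> \<open>The factor \<open>p * real T * \<gamma>\<close> is what the final division
      removes; the sign disappears under the absolute value.\<close>
    have "\<gamma> * (\<Sum>t = 1..T. p * (\<alpha> - m t)) = - (p * real T * \<gamma>) * (1 / real T * (\<Sum>t = 1..T. m t) - \<alpha>)"
      unfolding eq using that by (simp add: field_simps)
    then have "\<bar>\<gamma> * (\<Sum>t = 1..T. p * (\<alpha> - m t))\<bar>
        = (p * real T * \<gamma>) * \<bar>1 / real T * (\<Sum>t = 1..T. m t) - \<alpha>\<bar>"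
      using pos by (metis abs_minus_cancel abs_mult abs_of_pos)
    then show ?thesis using total[of T] pos by (simp add: pos_le_divide_eq mult.commute)
  qed
  have "(\<lambda>T. 1 / real T * (\<Sum>t = 1..T. m t) - \<alpha>) \<longlonglongrightarrow> 0"
  proof (rule Lim_null_comparison)
    \<comment> \<open>The finite-horizon bound is a constant times \<open>1 / real T\<close> and is
      available from \<open>T = 1\<close> on.\<close>
    show "\<forall>\<^sub>F T in sequentially. norm (1 / real T * (\<Sum>t = 1..T. m t) - \<alpha>) \<le> ?B / (p * real T * \<gamma>)"
      using main by (auto simp: eventually_sequentially intro!: exI[of _ 1])
    have "(\<lambda>T. ?B / (p * \<gamma>) * (1 / real T)) \<longlonglongrightarrow> ?B / (p * \<gamma>) * 0"
      by (intro tendsto_intros lim_1_over_n)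
    then show "(\<lambda>T. ?B / (p * real T * \<gamma>)) \<longlonglongrightarrow> 0"
      by (simp add: field_simps)
  qed
  then have "(\<lambda>T. 1 / real T * (\<Sum>t = 1..T. m t)) \<longlonglongrightarrow> \<alpha>"
    by (rule LIM_zero_cancel)
  with main show ?thesis unfolding m_def by blast
qed

end
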